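(* Every $\mathbb{H}$-strongly predictable continuous process $R$ is an $\mathbb{H}$-weak Dirichlet process.
   Context: $(\Omega,\mathcal{F},P)$ is a probability space, processes are continuous, indexed by $t\in[0,1]$, with $X_t=X_{(t\vee0)\wedge1}$ for $t\in\mathbb{R}$. $\mathbb{H}=(\mathcal{H}_t)_{t\in[0,1]}$ is a filtration satisfying the usual assumptions. $R$ is ($\mathbb{H}$-)strongly predictable if there is $\delta>0$ such that the process $R_{\varepsilon+\cdot}$ is $\mathbb{H}$-adapted for every $\varepsilon\le\delta$. $[X,Y]$ is the limit, if it exists, of $\frac1\varepsilon\int_0^t(X_{s+\varepsilon}-X_s)(Y_{s+\varepsilon}-Y_s)\,ds$ as $\varepsilon\to0$, in probability uniformly in $t\in[0,1]$. An $\mathbb{H}$-weak Dirichlet process is the sum of a continuous $\mathbb{H}$-local martingale $M$ and a continuous process $Q$ such that $[Q,N]=0$ for every (continuous) $\mathbb{H}$-local martingale $N$. *)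

theory Defs
  imports "HOL-Probability.Probability"
begin

text \<open>
  Families indexed by \<open>t \<in> [0,1]\<close> (processes \<open>X t \<omega>\<close> and filtrations \<open>H t\<close>) are represented
  by functions on \<^typ>\<open>real\<close>, of which only the values on \<open>{0..1}\<close> matter. Indices outside
  \<open>{0..1}\<close> are reached only through \<open>extend\<close>, i.e. by the convention
  \<open>X\<^sub>t = X\<^bsub>(t \<or> 0) \<and> 1\<^esub>\<close>.
\<close>

definition extend :: "(real \<Rightarrow> 'b) \<Rightarrow> real \<Rightarrow> 'b" where
  "extend X t = X (min (max t 0) 1)"

text \<open>
  The null sets in the last condition are the events of the ambient sigma-algebra that have
  probability 0; the probability space itself need not be complete.
\<close>

definition usual_filtration :: "'a measure \<Rightarrow> (real \<Rightarrow> 'a measure) \<Rightarrow> bool" where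
  "usual_filtration M H \<longleftrightarrow>
     filtration (space M) (extend H) \<and>
     (\<forall>t\<in>{0..1}. subalgebra M (H t)) \<and>
     (\<forall>t\<in>{0..<1}. sets (H t) = (\<Inter>s\<in>{t<..1}. sets (H s))) \<and>
     null_sets M \<subseteq> sets (H 0)"

definition adapted :: "(real \<Rightarrow> 'a measure) \<Rightarrow> (real \<Rightarrow> 'a \<Rightarrow> real) \<Rightarrow> bool" where
  "adapted H X \<longleftrightarrow> (\<forall>t\<in>{0..1}. X t \<in> borel_measurable (H t))"

definition continuous_process :: "'a measure \<Rightarrow> (real \<Rightarrow> 'a \<Rightarrow> real) \<Rightarrow> bool" where
  "continuous_process M X \<longleftrightarrow>
     (\<forall>t\<in>{0..1}. X t \<in> borel_measurable M) \<and>
     (\<forall>\<omega>\<in>space M. continuous_on {0..1} (\<lambda>t. X t \<omega>))"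

definition strongly_predictable :: "(real \<Rightarrow> 'a measure) \<Rightarrow> (real \<Rightarrow> 'a \<Rightarrow> real) \<Rightarrow> bool" where
  "strongly_predictable H R \<longleftrightarrow>
     (\<exists>\<delta>>0. \<forall>\<epsilon>\<le>\<delta>. adapted H (\<lambda>t. extend R (\<epsilon> + t)))"

definition martingale :: "'a measure \<Rightarrow> (real \<Rightarrow> 'a measure) \<Rightarrow> (real \<Rightarrow> 'a \<Rightarrow> real) \<Rightarrow> bool" where
  "martingale M H X \<longleftrightarrow>
     adapted H X \<and> (\<forall>t\<in>{0..1}. integrable M (X t)) \<and>
     (\<forall>s\<in>{0..1}. \<forall>t\<in>{s..1}. AE \<omega> in M. real_cond_exp M (H s) (X t) \<omega> = X s \<omega>)"

text \<open>
  On the index set \<open>[0,1]\<close> only \<open>min (\<tau> n) 1\<close> matters for the stopped process, so the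
  localizing times are taken with values in \<open>[0,1]\<close>, and almost surely they must reach \<open>1\<close>
  after finitely many steps (not merely converge to \<open>1\<close>). The initial value
  need not be integrable.
\<close>

definition continuous_local_martingale ::
  "'a measure \<Rightarrow> (real \<Rightarrow> 'a measure) \<Rightarrow> (real \<Rightarrow> 'a \<Rightarrow> real) \<Rightarrow> bool" where
  "continuous_local_martingale M H N \<longleftrightarrow>
     continuous_process M N \<and> adapted H N \<and>
     (\<exists>\<tau> :: nat \<Rightarrow> 'a \<Rightarrow> real.
        (\<forall>n. stopping_time (extend H) (\<tau> n)) \<and>
        (\<forall>n. \<forall>\<omega>\<in>space M. \<tau> n \<omega> \<in> {0..1} \<and> \<tau> n \<omega> \<le> \<tau> (Suc n) \<omega>) \<and>
        (AE \<omega> in M. \<exists>n. \<tau> n \<omega> = 1) \<and>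
        (\<forall>n. martingale M H (\<lambda>t \<omega>. N (min t (\<tau> n \<omega>)) \<omega> - N 0 \<omega>)))"

definition covariation_approx ::
  "(real \<Rightarrow> 'a \<Rightarrow> real) \<Rightarrow> (real \<Rightarrow> 'a \<Rightarrow> real) \<Rightarrow> real \<Rightarrow> real \<Rightarrow> 'a \<Rightarrow> real" where
  "covariation_approx X Y \<epsilon> t \<omega> =
     (1 / \<epsilon>) * (LBINT s:{0..t}.
        (extend X (s + \<epsilon>) \<omega> - extend X s \<omega>) * (extend Y (s + \<epsilon>) \<omega> - extend Y s \<omega>))"

text \<open>
  \<open>has_covariation M X Y A\<close> means that \<open>[X,Y]\<close> exists and equals \<open>A\<close>, the limit being taken
  as \<open>\<epsilon>\<close> tends to \<open>0\<close> from above. For continuous \<open>X\<close>, \<open>Y\<close>, \<open>A\<close> the event below is measurable.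
\<close>

definition has_covariation ::
  "'a measure \<Rightarrow> (real \<Rightarrow> 'a \<Rightarrow> real) \<Rightarrow> (real \<Rightarrow> 'a \<Rightarrow> real) \<Rightarrow> (real \<Rightarrow> 'a \<Rightarrow> real) \<Rightarrow> bool" where
  "has_covariation M X Y A \<longleftrightarrow>
     continuous_process M A \<and>
     (\<forall>\<eta>>0. ((\<lambda>\<epsilon>. measure M {\<omega>\<in>space M.
          (SUP t\<in>{0..1}. ereal \<bar>covariation_approx X Y \<epsilon> t \<omega> - A t \<omega>\<bar>) > ereal \<eta>})
        \<longlongrightarrow> 0) (at_right 0))"

definition weak_dirichlet ::
  "'a measure \<Rightarrow> (real \<Rightarrow> 'a measure) \<Rightarrow> (real \<Rightarrow> 'a \<Rightarrow> real) \<Rightarrow> bool" where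
  "weak_dirichlet M H X \<longleftrightarrow>
     (\<exists>L Q. continuous_local_martingale M H L \<and> continuous_process M Q \<and>
        (\<forall>t\<in>{0..1}. \<forall>\<omega>\<in>space M. X t \<omega> = L t \<omega> + Q t \<omega>) \<and>
        (\<forall>N. continuous_local_martingale M H N \<longrightarrow> has_covariation M Q N (\<lambda>t \<omega>. 0)))"

end

theory Submission
  imports Defs
begin

text \<open>
  One can take 0 for the local martingale part, because a strongly predictable continuous process \<open>R\<close>
  satisfies \<open>[R, N] = 0\<close> for every continuous local martingale \<open>N\<close>. Heuristically, exchanging the order of
  integration gives, up to a small boundary term,
  \<open>1/\<epsilon> \<integral>\<^sub>0\<^sup>t (R\<^bsub>s+\<epsilon>\<^esub> - R\<^sub>s) (N\<^bsub>s+\<epsilon>\<^esub> - N\<^sub>s) ds \<approx> \<integral>\<^sub>0\<^sup>t V\<^sub>u dN\<^sub>u\<close> with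
  \<open>V\<^sub>u = 1/\<epsilon> \<integral>\<^bsub>u-\<epsilon>\<^esub>\<^sup>u (R\<^bsub>s+\<epsilon>\<^esub> - R\<^sub>s) ds\<close>. For small \<open>\<epsilon>\<close> strong predictability makes \<open>V\<close> adapted, and
  path continuity makes \<open>V\<close> uniformly small, so the stochastic integral is uniformly small in
  probability.

  The proof makes this rigorous without stochastic integration. On a grid of mesh \<open>\<epsilon> / m\<close> the time
  integral becomes a Riemann sum, and summation by parts (\<open>sum_shift_eq_transform\<close>) turns it into a
  transform of a discrete martingale by multipliers of modulus at most \<open>c\<close>, the oscillation of \<open>R\<close> at
  scale \<open>\<epsilon>\<close>. Localisation yields a martingale \<open>X\<close> that is integrable but possibly not square
  integrable, so Doob's inequality is replaced by Burkholder's weak-type inequality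
  (\<open>prob_max_transform_ge\<close>): the maximum of such a transform reaches the level \<open>r\<close> with
  probability at most \<open>2 c E\<bar>X\<^sub>1\<bar> / r\<close>. It follows from a supermartingale property of the function
  \<open>burkholder_U\<close>. The bound is uniform in \<open>m\<close>, hence survives the limit \<open>m \<rightarrow> \<infinity>\<close> by Fatou's lemma, and it
  tends to 0 with \<open>c\<close>.
\<close>

section \<open>Burkholder's special function\<close>

text \<open>
  Burkholder's function for the weak-type (1,1) inequality: it dominates
  \<open>1\<^bsub>{\<bar>y\<bar> \<ge> 1}\<^esub> - 2 \<bar>x\<bar>\<close>, vanishes at the origin, and is concave along every line whose slope
  has modulus at most 1, that is, along the steps of a pair (martingale, transform of it by
  multipliers bounded by 1).
\<close>

definition burkholder_U :: "real \<Rightarrow> real \<Rightarrow> real" where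
  "burkholder_U x y = (if \<bar>x\<bar> + \<bar>y\<bar> < 1 then y\<^sup>2 - x\<^sup>2 else 1 - 2 * \<bar>x\<bar>)"

text \<open>
  The partial derivatives of \<open>burkholder_U\<close>, with one choice of supergradient on the boundary
  of the square and, outside it, at \<open>x = 0\<close>. Their boundedness makes the weak-type inequality
  available for martingales that are merely integrable.
\<close>

definition burkholder_Ux :: "real \<Rightarrow> real \<Rightarrow> real" where
  "burkholder_Ux x y = (if \<bar>x\<bar> + \<bar>y\<bar> < 1 then - 2 * x else - 2 * sgn x)"

definition burkholder_Uy :: "real \<Rightarrow> real \<Rightarrow> real" where
  "burkholder_Uy x y = (if \<bar>x\<bar> + \<bar>y\<bar> < 1 then 2 * y else 0)"

text \<open>
  On the whole plane \<open>burkholder_U\<close> lies below its outer branch, since inside the square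
  \<open>\<bar>y\<bar> < 1 - \<bar>x\<bar>\<close>. This is what makes the linear bound for steps starting outside trivial:
  it is then the concavity of \<open>1 - 2 \<bar>x\<bar>\<close>.
\<close>

lemma burkholder_U_le: "burkholder_U x y \<le> 1 - 2 * \<bar>x\<bar>"
proof (cases "\<bar>x\<bar> + \<bar>y\<bar> < 1")
  case True
  then have "\<bar>y\<bar>\<^sup>2 \<le> (1 - \<bar>x\<bar>)\<^sup>2"
    by (intro power_mono) auto
  then show ?thesis
    using True by (simp add: burkholder_U_def power2_eq_square algebra_simps)
qed (simp add: burkholder_U_def)

lemma burkholder_U_ge: "of_bool (1 \<le> \<bar>y\<bar>) - 2 * \<bar>x\<bar> \<le> burkholder_U x y"
proof (cases "\<bar>x\<bar> + \<bar>y\<bar> < 1")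
  case True
  then have "\<bar>x\<bar>\<^sup>2 \<le> \<bar>x\<bar>"
    using mult_left_le[of "\<bar>x\<bar>" "\<bar>x\<bar>"] unfolding power2_eq_square by linarith
  then have "x\<^sup>2 \<le> 2 * \<bar>x\<bar> + y\<^sup>2"
    using zero_le_power2[of y] unfolding power2_abs by linarith
  moreover have "\<not> 1 \<le> \<bar>y\<bar>"
    using True by linarith
  ultimately show ?thesis
    using True by (simp add: burkholder_U_def)
qed (simp add: burkholder_U_def)

text \<open>
  The critical case of the concavity of \<open>burkholder_U\<close>: a step from inside the square to a point
  with first coordinate above 1, with \<open>a = 1 - x\<close> the distance to the line of abscissa 1. After
  bounding the mixed term by its worst value, the expression factors into
  \<open>(a - \<bar>y\<bar>) (2 h - a - \<bar>y\<bar>)\<close>.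
\<close>

lemma burkholder_U_step_right:
  fixes a h k y :: real
  assumes "\<bar>y\<bar> < a" "a < h" "\<bar>k\<bar> \<le> h"
  shows "0 \<le> y\<^sup>2 + 2 * y * k + 2 * h * a - a\<^sup>2"
proof -
  have "\<bar>y\<bar> * \<bar>k\<bar> \<le> \<bar>y\<bar> * h"
    using assms by (intro mult_left_mono) auto
  moreover have "- (y * k) \<le> \<bar>y\<bar> * \<bar>k\<bar>"
    by (metis abs_ge_minus_self abs_mult)
  moreover have "0 \<le> (a - \<bar>y\<bar>) * (2 * h - a - \<bar>y\<bar>)"
    using assms by (intro mult_nonneg_nonneg) auto
  moreover have "(a - \<bar>y\<bar>) * (2 * h - a - \<bar>y\<bar>) = y\<^sup>2 - 2 * (\<bar>y\<bar> * h) + 2 * h * a - a\<^sup>2"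
    by (simp add: power2_eq_square algebra_simps)
  ultimately show ?thesis
    by linarith
qed

text \<open>
  Concavity of \<open>burkholder_U\<close> in directions of slope at most 1, as a supergradient inequality. From
  inside the square to a point of the strip \<open>\<bar>x + h\<bar> \<le> 1\<close> outside the square, the quadratic branch
  is still an upper bound there, and its second-order term \<open>k\<^sup>2 - h\<^sup>2\<close> is not positive.
\<close>

lemma burkholder_U_step:
  assumes "\<bar>k\<bar> \<le> \<bar>h\<bar>"
  shows "burkholder_U (x + h) (y + k)
    \<le> burkholder_U x y + burkholder_Ux x y * h + burkholder_Uy x y * k"
proof (cases "\<bar>x\<bar> + \<bar>y\<bar> < 1")
  case False
  have "1 - 2 * \<bar>x + h\<bar> \<le> 1 - 2 * \<bar>x\<bar> - 2 * sgn x * h"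
    by (auto simp: sgn_if abs_if)
  then show ?thesis
    using False burkholder_U_le[of "x + h" "y + k"]
    by (simp add: burkholder_U_def burkholder_Ux_def burkholder_Uy_def)
next
  case inside: True
  have sq: "k\<^sup>2 \<le> h\<^sup>2"
    using assms by (simp add: abs_le_square_iff)
  have *: "y\<^sup>2 - x\<^sup>2 - 2 * x * h + 2 * y * k = (y + k)\<^sup>2 - (x + h)\<^sup>2 + (h\<^sup>2 - k\<^sup>2)"
    by (simp add: power2_eq_square algebra_simps)
  have "burkholder_U (x + h) (y + k) \<le> y\<^sup>2 - x\<^sup>2 - 2 * x * h + 2 * y * k"
  proof (cases "\<bar>x + h\<bar> + \<bar>y + k\<bar> < 1")
    case True
    then show ?thesis
      unfolding * using sq by (simp add: burkholder_U_def)
  next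
    case outside: False
    consider "\<bar>x + h\<bar> \<le> 1" | "1 < x + h" | "x + h < - 1"
      by linarith
    then have "1 - 2 * \<bar>x + h\<bar> \<le> y\<^sup>2 - x\<^sup>2 - 2 * x * h + 2 * y * k"
    proof cases
      case 1
      then have "(1 - \<bar>x + h\<bar>)\<^sup>2 \<le> \<bar>y + k\<bar>\<^sup>2"
        using outside by (intro power_mono) auto
      moreover have "(1 - \<bar>x + h\<bar>)\<^sup>2 = 1 - 2 * \<bar>x + h\<bar> + (x + h)\<^sup>2"
        by (simp add: power2_diff)
      ultimately have "1 - 2 * \<bar>x + h\<bar> \<le> (y + k)\<^sup>2 - (x + h)\<^sup>2"
        by simp
      then show ?thesis
        unfolding * using sq by simp
    next
      case 2
      then have "0 \<le> y\<^sup>2 + 2 * y * k + 2 * h * (1 - x) - (1 - x)\<^sup>2"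
        using inside assms by (intro burkholder_U_step_right) auto
      moreover have "y\<^sup>2 + 2 * y * k + 2 * h * (1 - x) - (1 - x)\<^sup>2
          = (y\<^sup>2 - x\<^sup>2 - 2 * x * h + 2 * y * k) - (1 - 2 * (x + h))"
        by (simp add: power2_eq_square algebra_simps)
      ultimately show ?thesis
        using 2 by linarith
    next
      case 3
      then have "0 \<le> y\<^sup>2 + 2 * y * k + 2 * (- h) * (1 + x) - (1 + x)\<^sup>2"
        using inside assms by (intro burkholder_U_step_right) auto
      moreover have "y\<^sup>2 + 2 * y * k + 2 * (- h) * (1 + x) - (1 + x)\<^sup>2
          = (y\<^sup>2 - x\<^sup>2 - 2 * x * h + 2 * y * k) - (1 + 2 * (x + h))"
        by (simp add: power2_eq_square algebra_simps)
      ultimately show ?thesis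
        using 3 by linarith
    qed
    then show ?thesis
      using outside by (simp add: burkholder_U_def)
  qed
  then show ?thesis
    using inside by (simp add: burkholder_U_def burkholder_Ux_def burkholder_Uy_def)
qed

lemma abs_burkholder_U_le: "\<bar>burkholder_U x y\<bar> \<le> 1 + 2 * \<bar>x\<bar>"
  using burkholder_U_le[of x y] burkholder_U_ge[of y x] by (cases "1 \<le> \<bar>y\<bar>") auto

lemma abs_burkholder_Ux_le: "\<bar>burkholder_Ux x y\<bar> \<le> 2"
  by (auto simp: burkholder_Ux_def sgn_if abs_if)

lemma abs_burkholder_Uy_le: "\<bar>burkholder_Uy x y\<bar> \<le> 2"
  by (auto simp: burkholder_Uy_def abs_if)

lemma measurable_burkholder [measurable]:
  assumes [measurable]: "f \<in> borel_measurable A" "g \<in> borel_measurable A"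
  shows "(\<lambda>\<omega>. burkholder_U (f \<omega>) (g \<omega>)) \<in> borel_measurable A"
    and "(\<lambda>\<omega>. burkholder_Ux (f \<omega>) (g \<omega>)) \<in> borel_measurable A"
    and "(\<lambda>\<omega>. burkholder_Uy (f \<omega>) (g \<omega>)) \<in> borel_measurable A"
  unfolding burkholder_U_def burkholder_Ux_def burkholder_Uy_def by measurable

section \<open>A maximal inequality for transforms of integrable martingales\<close>

lemma integrable_bounded_mult:
  assumes "W \<in> borel_measurable M" "\<And>\<omega>. \<omega> \<in> space M \<Longrightarrow> \<bar>W \<omega>\<bar> \<le> b" "integrable M g"
  shows "integrable M (\<lambda>\<omega>. W \<omega> * g \<omega> :: real)"
proof (rule Bochner_Integration.integrable_bound)
  show "integrable M (\<lambda>\<omega>. b * g \<omega>)"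
    using assms by simp
  show "(\<lambda>\<omega>. W \<omega> * g \<omega>) \<in> borel_measurable M"
    using assms by auto
  show "AE \<omega> in M. norm (W \<omega> * g \<omega>) \<le> norm (b * g \<omega>)"
    using assms(2) by (intro AE_I2) (fastforce simp: abs_mult intro!: mult_right_mono)
qed

text \<open>
  Time-discretised martingales started at 0. The martingale property is required in the form in
  which it is used: increments are orthogonal to bounded functions known at the start of the step.
\<close>

locale discrete_martingale = prob_space M for M :: "'a measure" +
  fixes F :: "nat \<Rightarrow> 'a measure" and f :: "nat \<Rightarrow> 'a \<Rightarrow> real"
  assumes subalg: "subalgebra M (F k)"
    and subalg_Suc: "subalgebra (F (Suc k)) (F k)"
    and f_adapted [measurable]: "f k \<in> borel_measurable (F k)"
    and f_integrable: "integrable M (f k)"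
    and f_zero: "\<omega> \<in> space M \<Longrightarrow> f 0 \<omega> = 0"
    and f_orthogonal: "\<lbrakk>W \<in> borel_measurable (F k); \<And>\<omega>. \<omega> \<in> space M \<Longrightarrow> \<bar>W \<omega>\<bar> \<le> b\<rbrakk>
      \<Longrightarrow> (\<integral>\<omega>. W \<omega> * (f (Suc k) \<omega> - f k \<omega>) \<partial>M) = 0"
begin

definition transform :: "(nat \<Rightarrow> 'a \<Rightarrow> real) \<Rightarrow> nat \<Rightarrow> 'a \<Rightarrow> real" where
  "transform v n \<omega> = (\<Sum>u<n. v u \<omega> * (f (Suc u) \<omega> - f u \<omega>))"

lemma adapted_le:
  assumes "j \<le> k" "g \<in> borel_measurable (F j)"
  shows "g \<in> borel_measurable (F k)"
  using assms
proof (induction k rule: dec_induct)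
  case (step k)
  then show ?case
    using measurable_from_subalg[OF subalg_Suc] by blast
qed

lemma adapted_M: "g \<in> borel_measurable (F k) \<Longrightarrow> g \<in> borel_measurable M"
  using measurable_from_subalg[OF subalg] by blast

lemma transform_adapted:
  assumes "\<And>k. v k \<in> borel_measurable (F k)" "j \<le> k"
  shows "transform v j \<in> borel_measurable (F k)"
proof -
  have "(\<lambda>\<omega>. v u \<omega> * (f (Suc u) \<omega> - f u \<omega>)) \<in> borel_measurable (F k)" if "u < j" for u
    using that assms by (intro borel_measurable_times borel_measurable_diff
        adapted_le[of "Suc u" k "f (Suc u)"] adapted_le[of u k]) auto
  then show ?thesis
    unfolding transform_def by (intro borel_measurable_sum) auto
qed

lemma integrable_burkholder_U:
  assumes "\<And>k. v k \<in> borel_measurable (F k)"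
  shows "integrable M (\<lambda>\<omega>. burkholder_U (a * f n \<omega>) (transform v n \<omega>))"
proof (rule Bochner_Integration.integrable_bound)
  have [measurable]: "f n \<in> borel_measurable M" "transform v n \<in> borel_measurable M"
    using adapted_M[OF f_adapted] adapted_M[OF transform_adapted[OF assms order_refl]] by auto
  show "(\<lambda>\<omega>. burkholder_U (a * f n \<omega>) (transform v n \<omega>)) \<in> borel_measurable M"
    by measurable
  show "integrable M (\<lambda>\<omega>. 1 + 2 * \<bar>a * f n \<omega>\<bar>)"
    using f_integrable by (intro Bochner_Integration.integrable_add integrable_mult_right integrable_abs) auto
  show "AE \<omega> in M. norm (burkholder_U (a * f n \<omega>) (transform v n \<omega>)) \<le> norm (1 + 2 * \<bar>a * f n \<omega>\<bar>)"
    using abs_burkholder_U_le by (intro AE_I2) fastforce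
qed

text \<open>
  \<open>burkholder_U (a f\<^sub>n) g\<^sub>n\<close>, where \<open>g\<close> is the transform, is a supermartingale started at 0:
  each step is bounded by its linearisation, whose coefficients are bounded and known at the start
  of the step, so that they are orthogonal to the increment of \<open>f\<close>.
\<close>

lemma expectation_burkholder_U_le_0:
  assumes v: "\<And>k. v k \<in> borel_measurable (F k)"
    and v_le: "\<And>k \<omega>. \<omega> \<in> space M \<Longrightarrow> \<bar>v k \<omega>\<bar> \<le> a"
  shows "(\<integral>\<omega>. burkholder_U (a * f n \<omega>) (transform v n \<omega>) \<partial>M) \<le> 0"
proof (induction n)
  case 0
  have "(\<integral>\<omega>. burkholder_U (a * f 0 \<omega>) (transform v 0 \<omega>) \<partial>M) = (\<integral>\<omega>. 0 \<partial>M)"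
    by (intro Bochner_Integration.integral_cong) (auto simp: f_zero transform_def burkholder_U_def)
  then show ?case
    by simp
next
  case (Suc n)
  define d where "d \<omega> = f (Suc n) \<omega> - f n \<omega>" for \<omega>
  define p where "p \<omega> = a * burkholder_Ux (a * f n \<omega>) (transform v n \<omega>)" for \<omega>
  define q where "q \<omega> = burkholder_Uy (a * f n \<omega>) (transform v n \<omega>) * v n \<omega>" for \<omega>
  note [measurable] = v transform_adapted[OF v order_refl]
  have p: "p \<in> borel_measurable (F n)" and q: "q \<in> borel_measurable (F n)"
    unfolding p_def q_def by measurable
  have p_le: "\<bar>p \<omega>\<bar> \<le> a * 2" if "\<omega> \<in> space M" for \<omega>
    unfolding p_def abs_mult using v_le[OF that, of 0] abs_burkholder_Ux_le by (intro mult_mono) auto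
  have q_le: "\<bar>q \<omega>\<bar> \<le> 2 * a" if "\<omega> \<in> space M" for \<omega>
    unfolding q_def abs_mult using v_le[OF that, of n] abs_burkholder_Uy_le by (intro mult_mono) auto
  have d: "integrable M d"
    unfolding d_def using f_integrable by auto
  have ip: "integrable M (\<lambda>\<omega>. p \<omega> * d \<omega>)" and iq: "integrable M (\<lambda>\<omega>. q \<omega> * d \<omega>)"
    using integrable_bounded_mult[OF adapted_M[OF p] p_le d]
      integrable_bounded_mult[OF adapted_M[OF q] q_le d] by auto
  have "(\<integral>\<omega>. burkholder_U (a * f (Suc n) \<omega>) (transform v (Suc n) \<omega>) \<partial>M)
      \<le> (\<integral>\<omega>. burkholder_U (a * f n \<omega>) (transform v n \<omega>) + (p \<omega> * d \<omega> + q \<omega> * d \<omega>) \<partial>M)"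
  proof (rule integral_mono)
    fix \<omega> assume "\<omega> \<in> space M"
    then have "\<bar>v n \<omega> * d \<omega>\<bar> \<le> \<bar>a * d \<omega>\<bar>"
      using v_le[of \<omega> n] by (auto simp: abs_mult intro!: mult_right_mono)
    from burkholder_U_step[OF this, of "a * f n \<omega>" "transform v n \<omega>"]
    show "burkholder_U (a * f (Suc n) \<omega>) (transform v (Suc n) \<omega>)
      \<le> burkholder_U (a * f n \<omega>) (transform v n \<omega>) + (p \<omega> * d \<omega> + q \<omega> * d \<omega>)"
      by (simp add: d_def p_def q_def transform_def algebra_simps)
  qed (use integrable_burkholder_U[OF v] ip iq in auto)
  also have "\<dots> = (\<integral>\<omega>. burkholder_U (a * f n \<omega>) (transform v n \<omega>) \<partial>M)"
    using integrable_burkholder_U[OF v] ip iq f_orthogonal[OF p p_le] f_orthogonal[OF q q_le]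
    by (simp add: d_def)
  finally show ?case
    using Suc.IH by simp
qed

lemma prob_transform_ge_1:
  assumes v: "\<And>k. v k \<in> borel_measurable (F k)"
    and v_le: "\<And>k \<omega>. \<omega> \<in> space M \<Longrightarrow> \<bar>v k \<omega>\<bar> \<le> a"
  shows "prob {\<omega> \<in> space M. 1 \<le> \<bar>transform v n \<omega>\<bar>} \<le> 2 * a * (\<integral>\<omega>. \<bar>f n \<omega>\<bar> \<partial>M)"
proof -
  let ?A = "{\<omega> \<in> space M. 1 \<le> \<bar>transform v n \<omega>\<bar>}"
  have [measurable]: "transform v n \<in> borel_measurable M"
    using adapted_M[OF transform_adapted[OF v order_refl]] .
  have A [measurable]: "?A \<in> sets M"
    by measurable
  obtain \<omega>0 where "\<omega>0 \<in> space M"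
    using not_empty by auto
  then have a: "0 \<le> a"
    using v_le[of \<omega>0 0] by auto
  have "prob ?A - 2 * a * (\<integral>\<omega>. \<bar>f n \<omega>\<bar> \<partial>M) = (\<integral>\<omega>. indicator ?A \<omega> - 2 * a * \<bar>f n \<omega>\<bar> \<partial>M)"
    using A f_integrable[of n] by (subst Bochner_Integration.integral_diff) (auto simp: emeasure_eq_measure)
  also have "\<dots> \<le> (\<integral>\<omega>. burkholder_U (a * f n \<omega>) (transform v n \<omega>) \<partial>M)"
  proof (rule integral_mono)
    show "integrable M (\<lambda>\<omega>. indicator ?A \<omega> - 2 * a * \<bar>f n \<omega>\<bar>)"
      using A f_integrable[of n] by (auto simp: emeasure_eq_measure)
    fix \<omega> assume "\<omega> \<in> space M"
    then show "indicator ?A \<omega> - 2 * a * \<bar>f n \<omega>\<bar> \<le> burkholder_U (a * f n \<omega>) (transform v n \<omega>)"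
      using burkholder_U_ge[of "transform v n \<omega>" "a * f n \<omega>"] a
      by (simp add: indicator_def abs_mult of_bool_def)
  qed (use integrable_burkholder_U[OF v] in auto)
  also have "\<dots> \<le> 0"
    using expectation_burkholder_U_le_0[OF v v_le] .
  finally show ?thesis
    by simp
qed

text \<open>
  The weak-type inequality for the maximum follows from the one at a fixed time: setting the
  multipliers to 0 once the level \<open>r\<close> is reached freezes the transform at a value of modulus at
  least \<open>r\<close>, and the new multipliers are still known at the start of each step.
\<close>

lemma prob_max_transform_ge:
  assumes v: "\<And>k. v k \<in> borel_measurable (F k)"
    and v_le: "\<And>k \<omega>. \<omega> \<in> space M \<Longrightarrow> \<bar>v k \<omega>\<bar> \<le> c"
    and "0 < r"
  shows "prob {\<omega> \<in> space M. \<exists>j\<le>n. r \<le> \<bar>transform v j \<omega>\<bar>} \<le> 2 * c / r * (\<integral>\<omega>. \<bar>f n \<omega>\<bar> \<partial>M)"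
proof -
  define w where "w u \<omega> = (if \<forall>j\<le>u. \<bar>transform v j \<omega>\<bar> < r then v u \<omega> / r else 0)" for u \<omega>
  have w: "w u \<in> borel_measurable (F u)" for u
  proof -
    have pred: "Measurable.pred (F u) (\<lambda>\<omega>. \<forall>j\<le>u. \<bar>transform v j \<omega>\<bar> < r)"
    proof -
      have "Measurable.pred (F u) (\<lambda>\<omega>. \<forall>j\<in>{..u}. \<bar>transform v j \<omega>\<bar> < r)"
      proof (rule pred_intros_finite(3))
        fix j assume "j \<in> {..u}"
        then have [measurable]: "transform v j \<in> borel_measurable (F u)"
          using transform_adapted[OF v] by auto
        show "Measurable.pred (F u) (\<lambda>\<omega>. \<bar>transform v j \<omega>\<bar> < r)"
          by measurable
      qed simp
      then show ?thesis
        by (simp only: Ball_def atMost_iff)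
    qed
    show ?thesis
      unfolding w_def by (intro measurable_If borel_measurable_divide v borel_measurable_const)
        (use pred in \<open>simp only: Measurable.pred_def\<close>)
  qed
  have w_le: "\<bar>w u \<omega>\<bar> \<le> c / r" if "\<omega> \<in> space M" for u \<omega>
    using v_le[OF that, of u] \<open>0 < r\<close> by (auto simp: w_def intro!: divide_right_mono)
  have stop: "1 \<le> \<bar>transform w n \<omega>\<bar>" if j: "j \<le> n" "r \<le> \<bar>transform v j \<omega>\<bar>" for j \<omega>
  proof -
    define k where "k = (LEAST i. r \<le> \<bar>transform v i \<omega>\<bar>)"
    have k: "r \<le> \<bar>transform v k \<omega>\<bar>"
      unfolding k_def using j(2) by (rule LeastI)
    have "k \<le> j"
      unfolding k_def using j(2) by (rule Least_le)
    then have "k \<le> n"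
      using j(1) by simp
    have before: "\<bar>transform v i \<omega>\<bar> < r" if "i < k" for i
      using not_less_Least[of i "\<lambda>i. r \<le> \<bar>transform v i \<omega>\<bar>"] that by (auto simp: k_def)
    have "transform w n \<omega> = (\<Sum>u<k. w u \<omega> * (f (Suc u) \<omega> - f u \<omega>))"
      unfolding transform_def using \<open>k \<le> n\<close> k
      by (intro sum.mono_neutral_right) (auto simp: w_def not_less intro!: exI[of _ k])
    also have "\<dots> = (\<Sum>u<k. v u \<omega> * (f (Suc u) \<omega> - f u \<omega>) / r)"
      using before by (intro sum.cong) (auto simp: w_def)
    also have "\<dots> = transform v k \<omega> / r"
      by (simp add: transform_def sum_divide_distrib)
    finally show ?thesis
      using k \<open>0 < r\<close> by simp
  qed
  have [measurable]: "transform w n \<in> borel_measurable M"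
    using adapted_M[OF transform_adapted[OF w order_refl]] .
  have "prob {\<omega> \<in> space M. \<exists>j\<le>n. r \<le> \<bar>transform v j \<omega>\<bar>} \<le> prob {\<omega> \<in> space M. 1 \<le> \<bar>transform w n \<omega>\<bar>}"
    using stop by (intro finite_measure_mono) auto
  also have "\<dots> \<le> 2 * (c / r) * (\<integral>\<omega>. \<bar>f n \<omega>\<bar> \<partial>M)"
    using prob_transform_ge_1[OF w w_le] .
  finally show ?thesis
    by simp
qed

end

section \<open>Passing to the limit in probabilities\<close>

lemma (in prob_space) ex_small_complement:
  assumes P [measurable]: "\<And>k::nat. Measurable.pred M (P k)"
    and mono: "\<And>k \<omega>. \<lbrakk>\<omega> \<in> space M; P k \<omega>\<rbrakk> \<Longrightarrow> P (Suc k) \<omega>"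
    and ae: "AE \<omega> in M. \<exists>k. P k \<omega>"
    and "0 < \<rho>"
  shows "\<exists>k. prob {\<omega>\<in>space M. \<not> P k \<omega>} < \<rho>"
proof -
  define A where "A k = {\<omega>\<in>space M. P k \<omega>}" for k
  have A: "range A \<subseteq> sets M"
    unfolding A_def by auto
  have "incseq A"
    using mono by (intro incseq_SucI) (auto simp: A_def)
  with A have "(\<lambda>k. prob (A k)) \<longlonglongrightarrow> prob (\<Union>k. A k)"
    by (rule finite_Lim_measure_incseq)
  moreover have "prob (\<Union>k. A k) = 1"
  proof (subst prob_eq_1)
    show "(\<Union>k. A k) \<in> events"
      using A by auto
    show "AE \<omega> in M. \<omega> \<in> (\<Union>k. A k)"
      using ae AE_space by eventually_elim (auto simp: A_def)
  qed
  ultimately have "\<forall>\<^sub>F k in sequentially. 1 - \<rho> < prob (A k)"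
    using \<open>0 < \<rho>\<close> by (intro order_tendstoD) auto
  then obtain k where "1 - \<rho> < prob (A k)"
    using eventually_happens by fastforce
  moreover have "prob {\<omega>\<in>space M. \<not> P k \<omega>} = 1 - prob (A k)"
    unfolding A_def by (rule prob_neg) measurable
  ultimately show ?thesis
    by (intro exI[of _ k]) simp
qed

text \<open>
  Fatou's lemma for sets. It transfers the maximal inequality, uniform in the mesh of the time
  grid, to the integral with respect to time.
\<close>

lemma (in finite_measure) measure_eventually_le:
  assumes B: "\<And>m::nat. B m \<in> sets M" and le: "\<And>m. measure M (B m) \<le> b"
    and A: "\<And>\<omega>. \<omega> \<in> A \<Longrightarrow> \<forall>\<^sub>F m in sequentially. \<omega> \<in> B m"
  shows "measure M A \<le> b"
proof -
  define C where "C k = (\<Inter>m\<in>{k..}. B m)" for k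
  have C: "C k \<in> sets M" for k
    unfolding C_def using B by (intro sets.countable_INT') auto
  have C_le: "measure M (C k) \<le> b" for k
    using le[of k] finite_measure_mono[OF _ B, of "C k" k] by (force simp: C_def)
  have "incseq C"
    by (intro incseq_SucI) (auto simp: C_def)
  then have "(\<lambda>k. measure M (C k)) \<longlonglongrightarrow> measure M (\<Union>k. C k)"
    using C by (intro finite_Lim_measure_incseq) auto
  then have "measure M (\<Union>k. C k) \<le> b"
    using C_le by (intro LIMSEQ_le_const2) auto
  moreover have "A \<subseteq> (\<Union>k. C k)"
    using A by (fastforce simp: C_def eventually_sequentially)
  then have "measure M A \<le> measure M (\<Union>k. C k)"
    using C by (intro finite_measure_mono) auto
  ultimately show ?thesis
    by simp
qed

lemma continuous_on_extend:
  assumes "continuous_process M X" "\<omega> \<in> space M"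
  shows "continuous_on A (\<lambda>t. extend X t \<omega>)"
proof -
  have "continuous_on {0..1} (\<lambda>t. X t \<omega>)"
    using assms by (simp add: continuous_process_def)
  then show ?thesis
    unfolding extend_def
    by (rule continuous_on_compose2) (auto intro!: continuous_intros)
qed

lemma extend_measurable:
  "continuous_process M X \<Longrightarrow> extend X t \<in> borel_measurable M"
  by (auto simp: continuous_process_def extend_def)

lemma rational_approx: "\<exists>p :: nat \<Rightarrow> rat. (\<lambda>n. real_of_rat (p n)) \<longlonglongrightarrow> s"
proof -
  have "s \<in> closure \<rat>"
    by (simp add: Rats_closure_real)
  then obtain f where f: "\<And>n. f n \<in> \<rat>" "f \<longlonglongrightarrow> s"
    by (auto simp: closure_sequential)
  from f(1) have "\<forall>n. \<exists>q. f n = real_of_rat q"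
    by (auto simp: Rats_def)
  then obtain p where "\<And>n. f n = real_of_rat (p n)"
    by metis
  then have "f = (\<lambda>n. real_of_rat (p n))"
    by auto
  then show ?thesis
    using f(2) by auto
qed

text \<open>
  A modulus of continuity can be read off from rational times, which makes the event that a
  continuous process obeys it measurable. The strict bound on \<open>\<bar>s - t\<bar>\<close> is what makes rational
  approximations of \<open>s\<close> and \<open>t\<close> satisfy it too.
\<close>

lemma modulus_from_rationals:
  fixes g :: "real \<Rightarrow> real"
  assumes g: "continuous_on UNIV g"
    and rat: "\<And>p q :: rat. \<bar>real_of_rat p - real_of_rat q\<bar> < \<kappa>
      \<Longrightarrow> \<bar>g (real_of_rat p) - g (real_of_rat q)\<bar> \<le> c"
    and "\<bar>s - t\<bar> < \<kappa>"
  shows "\<bar>g s - g t\<bar> \<le> c"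
proof -
  obtain p q where p: "(\<lambda>n. real_of_rat (p n)) \<longlonglongrightarrow> s" and q: "(\<lambda>n. real_of_rat (q n)) \<longlonglongrightarrow> t"
    using rational_approx by metis
  have "(\<lambda>n. \<bar>real_of_rat (p n) - real_of_rat (q n)\<bar>) \<longlonglongrightarrow> \<bar>s - t\<bar>"
    by (intro tendsto_intros p q)
  then have ev: "\<forall>\<^sub>F n in sequentially. \<bar>real_of_rat (p n) - real_of_rat (q n)\<bar> < \<kappa>"
    using assms(3) by (rule order_tendstoD)
  have "(\<lambda>n. \<bar>g (real_of_rat (p n)) - g (real_of_rat (q n))\<bar>) \<longlonglongrightarrow> \<bar>g s - g t\<bar>"
    using g p q by (intro tendsto_intros continuous_on_tendsto_compose[OF g]) auto
  then show ?thesis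
    by (rule tendsto_upperbound) (use ev rat in \<open>auto elim: eventually_mono\<close>)
qed

text \<open>
  Each path is uniformly continuous on the unit interval, so the events that a given oscillation
  bound \<open>c\<close> holds at scale \<open>1 / (k + 1)\<close> increase to the whole space.
\<close>

lemma (in prob_space) continuous_process_modulus:
  assumes X: "continuous_process M X" and "0 < c" "0 < \<rho>"
  shows "\<exists>\<kappa>>0. \<exists>G\<in>sets M. prob (space M - G) < \<rho> \<and>
    (\<forall>\<omega>\<in>G. \<forall>s t. \<bar>s - t\<bar> < \<kappa> \<longrightarrow> \<bar>extend X s \<omega> - extend X t \<omega>\<bar> \<le> c)"
proof -
  define P where "P k \<omega> \<longleftrightarrow> (\<forall>p q :: rat. \<bar>real_of_rat p - real_of_rat q\<bar> < 1 / real (Suc k) \<longrightarrow>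
    \<bar>extend X (real_of_rat p) \<omega> - extend X (real_of_rat q) \<omega>\<bar> \<le> c)" for k \<omega>
  note [measurable] = extend_measurable[OF X]
  have P [measurable]: "Measurable.pred M (P k)" for k
    unfolding P_def by measurable
  have "\<exists>k. prob {\<omega>\<in>space M. \<not> P k \<omega>} < \<rho>"
  proof (rule ex_small_complement[OF P])
    fix k \<omega> assume "P k \<omega>"
    moreover have "1 / real (Suc (Suc k)) \<le> 1 / real (Suc k)"
      by (simp add: field_simps)
    ultimately show "P (Suc k) \<omega>"
      unfolding P_def by (meson less_le_trans)
  next
    show "AE \<omega> in M. \<exists>k. P k \<omega>"
    proof (rule AE_I2)
      fix \<omega> assume "\<omega> \<in> space M"
      then have "continuous_on {0..1} (\<lambda>t. X t \<omega>)"
        using X by (simp add: continuous_process_def)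
      then have "uniformly_continuous_on {0..1} (\<lambda>t. X t \<omega>)"
        by (intro compact_uniformly_continuous) auto
      then obtain d where d: "0 < d"
        "\<And>s t. \<lbrakk>s \<in> {0..1}; t \<in> {0..1}; \<bar>s - t\<bar> < d\<rbrakk> \<Longrightarrow> \<bar>X s \<omega> - X t \<omega>\<bar> < c"
        using \<open>0 < c\<close> unfolding uniformly_continuous_on_def dist_real_def by metis
      obtain k where k: "1 / real (Suc k) < d"
        using nat_approx_posE[OF \<open>0 < d\<close>] by auto
      have "P k \<omega>"
        unfolding P_def
      proof (intro allI impI)
        fix p q :: rat
        assume "\<bar>real_of_rat p - real_of_rat q\<bar> < 1 / real (Suc k)"
        then have "\<bar>min (max (real_of_rat p) 0) 1 - min (max (real_of_rat q) 0) 1\<bar> < d"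
          using k by linarith
        then show "\<bar>extend X (real_of_rat p) \<omega> - extend X (real_of_rat q) \<omega>\<bar> \<le> c"
          unfolding extend_def by (intro less_imp_le d(2)) auto
      qed
      then show "\<exists>k. P k \<omega>" ..
    qed
  qed fact
  then obtain k where k: "prob {\<omega>\<in>space M. \<not> P k \<omega>} < \<rho>"
    by blast
  define G where "G = {\<omega>\<in>space M. P k \<omega>}"
  show ?thesis
  proof (intro exI[of _ "1 / real (Suc k)"] conjI bexI[of _ G])
    show "G \<in> sets M"
      unfolding G_def by measurable
    have "space M - G = {\<omega>\<in>space M. \<not> P k \<omega>}"
      by (auto simp: G_def)
    then show "prob (space M - G) < \<rho>"
      using k by simp
    show "\<forall>\<omega>\<in>G. \<forall>s t. \<bar>s - t\<bar> < 1 / real (Suc k) \<longrightarrow> \<bar>extend X s \<omega> - extend X t \<omega>\<bar> \<le> c"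
    proof (intro ballI allI impI)
      fix \<omega> s t assume "\<omega> \<in> G" and st: "\<bar>s - t\<bar> < 1 / real (Suc k)"
      then have \<omega>: "\<omega> \<in> space M" "P k \<omega>"
        by (auto simp: G_def)
      show "\<bar>extend X s \<omega> - extend X t \<omega>\<bar> \<le> c"
        by (rule modulus_from_rationals[OF continuous_on_extend[OF X \<omega>(1)] _ st])
          (use \<omega>(2) in \<open>auto simp: P_def\<close>)
    qed
  qed simp
qed

section \<open>Riemann sums and summation by parts\<close>

lemma riemann_sum_error:
  fixes g :: "real \<Rightarrow> real"
  assumes g: "continuous_on {0..1} g" and "0 < h"
    and mod: "\<And>s s'. \<lbrakk>s \<in> {0..1}; s' \<in> {0..1}; \<bar>s - s'\<bar> \<le> h\<rbrakk> \<Longrightarrow> \<bar>g s - g s'\<bar> \<le> e"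
    and "real j * h \<le> 1"
  shows "\<bar>integral {0..real j * h} g - h * (\<Sum>i<j. g (real i * h))\<bar> \<le> real j * h * e"
  using \<open>real j * h \<le> 1\<close>
proof (induction j)
  case 0
  then show ?case
    by simp
next
  case (Suc j)
  let ?s = "real j * h" and ?t = "real (Suc j) * h"
  have st: "0 \<le> ?s" "?s \<le> ?t" "?t \<le> 1" "?t - ?s = h"
    using Suc.prems \<open>0 < h\<close> by (auto simp: algebra_simps)
  have sub: "s \<in> {0..1}" if "s \<in> {?s..?t}" for s
    using that st unfolding atLeastAtMost_iff by linarith
  have int: "g integrable_on {0..?t}" "g integrable_on {?s..?t}"
  proof -
    show "g integrable_on {0..?t}"
      using st by (auto intro!: integrable_continuous_interval continuous_on_subset[OF g])
    show "g integrable_on {?s..?t}"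
      using sub by (intro integrable_continuous_interval continuous_on_subset[OF g]) blast
  qed
  have "integral {0..?t} g = integral {0..?s} g + integral {?s..?t} g"
    using Henstock_Kurzweil_Integration.integral_combine[OF st(1,2) int(1)] by simp
  moreover have "\<bar>integral {?s..?t} g - h * g ?s\<bar> \<le> e * (?t - ?s)"
  proof -
    have "integral {?s..?t} (\<lambda>s. g s - g ?s) = integral {?s..?t} g - h * g ?s"
      using int(2) st by (subst Henstock_Kurzweil_Integration.integral_diff) auto
    moreover have "norm (integral {?s..?t} (\<lambda>s. g s - g ?s)) \<le> e * (?t - ?s)"
    proof (rule integral_bound[OF st(2)])
      show "continuous_on {?s..?t} (\<lambda>s. g s - g ?s)"
        using sub by (intro continuous_intros continuous_on_subset[OF g]) blast
      fix s assume s: "s \<in> {?s..?t}"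
      then have "\<bar>s - ?s\<bar> \<le> h"
        using st(4) unfolding atLeastAtMost_iff by linarith
      then show "norm (g s - g ?s) \<le> e"
        unfolding real_norm_def using sub[OF s] sub[of ?s] st(2) by (intro mod) auto
    qed
    ultimately show ?thesis
      by simp
  qed
  moreover have "\<bar>integral {0..?s} g - h * (\<Sum>i<j. g (real i * h))\<bar> \<le> ?s * e"
    using Suc.IH st by linarith
  ultimately have "\<bar>integral {0..?t} g - (h * (\<Sum>i<j. g (real i * h)) + h * g ?s)\<bar> \<le> ?s * e + e * (?t - ?s)"
    by linarith
  then show ?case
    by (simp add: algebra_simps)
qed

text \<open>
  The grid \<open>{0, h, 2 h, \<dots>}\<close> is independent of the endpoint \<open>t\<close>; this matters because below \<open>t\<close>
  depends on the outcome whereas the grid must not. The incomplete last cell contributes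
  at most \<open>h sup \<bar>g\<bar>\<close>.
\<close>

lemma riemann_sum_limit:
  fixes g :: "real \<Rightarrow> real"
  assumes g: "continuous_on {0..1} g" and t: "t \<in> {0..1}" and "0 < e"
  shows "\<exists>h0>0. \<forall>h. 0 < h \<longrightarrow> h < h0 \<longrightarrow>
    \<bar>integral {0..t} g - h * (\<Sum>i<nat \<lfloor>t / h\<rfloor>. g (real i * h))\<bar> \<le> e"
proof -
  have "uniformly_continuous_on {0..1} g"
    using g by (intro compact_uniformly_continuous) auto
  then obtain d where d: "0 < d"
    "\<And>s s'. \<lbrakk>s \<in> {0..1}; s' \<in> {0..1}; \<bar>s - s'\<bar> < d\<rbrakk> \<Longrightarrow> \<bar>g s - g s'\<bar> < e / 2"
    using \<open>0 < e\<close> unfolding uniformly_continuous_on_def dist_real_def by (metis half_gt_zero)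
  have "bounded (g ` {0..1})"
    using g by (intro compact_imp_bounded compact_continuous_image) auto
  then obtain B where B: "0 < B" "\<And>s. s \<in> {0..1} \<Longrightarrow> \<bar>g s\<bar> \<le> B"
    unfolding bounded_pos by auto
  show ?thesis
  proof (intro exI[of _ "min d (e / (2 * B))"] conjI allI impI)
    show "0 < min d (e / (2 * B))"
      using d(1) B(1) \<open>0 < e\<close> by simp
    fix h assume h: "0 < h" "h < min d (e / (2 * B))"
    define j where "j = nat \<lfloor>t / h\<rfloor>"
    let ?s = "real j * h"
    have "real j = of_int \<lfloor>t / h\<rfloor>"
      using t h(1) by (simp add: j_def)
    then have "real j \<le> t / h" "t / h < real j + 1"
      by linarith+
    then have s: "?s \<le> t" "t - ?s \<le> h"
      using h(1) by (auto simp: field_simps)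
    have s01: "0 \<le> ?s" "?s \<le> 1"
      using s(1) t h(1) by auto
    have int: "g integrable_on {0..t}"
      using t by (auto intro!: integrable_continuous_interval continuous_on_subset[OF g])
    have "integral {0..t} g = integral {0..?s} g + integral {?s..t} g"
      using Henstock_Kurzweil_Integration.integral_combine[OF s01(1) s(1) int] by simp
    moreover have "\<bar>integral {0..?s} g - h * (\<Sum>i<j. g (real i * h))\<bar> \<le> ?s * (e / 2)"
      using h d s01 by (intro riemann_sum_error[OF g h(1)]) (auto intro!: less_imp_le)
    moreover have "?s * (e / 2) \<le> e / 2"
      using s01 \<open>0 < e\<close> by (intro mult_left_le_one_le) auto
    moreover have "norm (integral {?s..t} g) \<le> B * (t - ?s)"
    proof (rule integral_bound[OF s(1)])
      have sub: "s \<in> {0..1}" if "s \<in> {?s..t}" for s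
        using that s01(1) t unfolding atLeastAtMost_iff by linarith
      then show "continuous_on {?s..t} g"
        by (intro continuous_on_subset[OF g]) blast
      show "norm (g s) \<le> B" if "s \<in> {?s..t}" for s
        using B(2)[OF sub[OF that]] by simp
    qed
    moreover have "B * (t - ?s) \<le> B * h"
      using s(2) B(1) by (intro mult_left_mono) auto
    moreover have "B * h \<le> e / 2"
      using h(2) B(1) by (simp add: field_simps)
    ultimately show "\<bar>integral {0..t} g - h * (\<Sum>i<nat \<lfloor>t / h\<rfloor>. g (real i * h))\<bar> \<le> e"
      unfolding j_def[symmetric] real_norm_def by linarith
  qed
qed

text \<open>
  Summation by parts, the discrete counterpart of exchanging the time integral with the stochastic
  integral over \<open>[s, s + \<epsilon>]\<close>: a sum of increments over \<open>m\<close> steps, cut off at \<open>j\<close>, becomes a sum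
  over single steps, where step \<open>u\<close> is weighted by the coefficients of the last \<open>m\<close> indices up to \<open>u\<close>.
  For coefficients adapted to a filtration, this weight is thus known at time \<open>u\<close>.
\<close>

lemma sum_shift_eq_transform:
  fixes a x :: "nat \<Rightarrow> real"
  assumes "0 < m"
  shows "(\<Sum>i<j. a i * (x (min (i + m) j) - x i))
    = (\<Sum>u<j. (\<Sum>i\<in>{Suc u - m..u}. a i) * (x (Suc u) - x u))"
proof (induction j)
  case (Suc j)
  have "(\<Sum>i<Suc j. a i * (x (min (i + m) (Suc j)) - x i))
    = (\<Sum>i<Suc j. a i * (x (min (i + m) j) - x i) + (if j < i + m then a i * (x (Suc j) - x j) else 0))"
  proof (intro sum.cong refl)
    fix i
    consider "i + m \<le> j" | "j < i + m"
      by linarith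
    then show "a i * (x (min (i + m) (Suc j)) - x i)
        = a i * (x (min (i + m) j) - x i) + (if j < i + m then a i * (x (Suc j) - x j) else 0)"
      by cases (auto simp: min_absorb1 min_absorb2 algebra_simps)
  qed
  also have "\<dots> = (\<Sum>i<Suc j. a i * (x (min (i + m) j) - x i))
      + (\<Sum>i<Suc j. if j < i + m then a i * (x (Suc j) - x j) else 0)"
    by (rule sum.distrib)
  also have "(\<Sum>i<Suc j. if j < i + m then a i * (x (Suc j) - x j) else 0)
      = (\<Sum>i\<in>{Suc j - m..j}. a i * (x (Suc j) - x j))"
    by (intro sum.mono_neutral_cong_right) auto
  also have "(\<Sum>i<Suc j. a i * (x (min (i + m) j) - x i)) = (\<Sum>i<j. a i * (x (min (i + m) j) - x i))"
    by simp
  finally show ?case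
    using Suc.IH by (simp add: sum_distrib_right)
qed simp

text \<open>
  The cut-off at \<open>j\<close> changes at most \<open>m\<close> terms, each by at most \<open>c / m\<close>.
\<close>

lemma sum_shift_boundary:
  fixes a x :: "nat \<Rightarrow> real"
  assumes a: "\<And>i. \<bar>a i\<bar> \<le> c / real m" and x: "\<And>p q. \<lbrakk>q \<le> p; p \<le> q + m\<rbrakk> \<Longrightarrow> \<bar>x p - x q\<bar> \<le> 1"
    and "0 < m" "0 \<le> c"
  shows "\<bar>(\<Sum>i<j. a i * (x (i + m) - x i)) - (\<Sum>i<j. a i * (x (min (i + m) j) - x i))\<bar> \<le> c"
proof -
  have "(\<Sum>i<j. a i * (x (i + m) - x i)) - (\<Sum>i<j. a i * (x (min (i + m) j) - x i))
      = (\<Sum>i<j. a i * (x (i + m) - x (min (i + m) j)))"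
    by (simp add: sum_subtractf[symmetric] algebra_simps)
  also have "\<dots> = (\<Sum>i\<in>{j - m..<j}. a i * (x (i + m) - x j))"
    by (intro sum.mono_neutral_cong_right) (auto simp: min_absorb1 min_absorb2)
  also have "\<bar>\<dots>\<bar> \<le> (\<Sum>i\<in>{j - m..<j}. c / real m * 1)"
  proof (intro order_trans[OF sum_abs] sum_mono)
    fix i assume "i \<in> {j - m..<j}"
    then have "\<bar>x (i + m) - x j\<bar> \<le> 1"
      by (intro x) auto
    then show "\<bar>a i * (x (i + m) - x j)\<bar> \<le> c / real m * 1"
      unfolding abs_mult using a[of i] \<open>0 \<le> c\<close> by (intro mult_mono) auto
  qed
  also have "\<dots> = real (j - (j - m)) * (c / real m)"
    by simp
  also have "\<dots> \<le> real m * (c / real m)"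
    using \<open>0 \<le> c\<close> by (intro mult_right_mono) auto
  finally show ?thesis
    using \<open>0 < m\<close> by simp
qed

section \<open>From the regularised covariation to a martingale transform\<close>

text \<open>
  For a single pair of paths: with mesh \<open>\<epsilon> / m\<close>, the Riemann sum of the regularised covariation
  differs from it by at most \<open>\<eta> / 4\<close> for large \<open>m\<close>, and from the transform of \<open>x\<close> by at most
  \<open>c \<le> \<eta> / 4\<close>. The factor \<open>1 / \<epsilon>\<close> and the mesh combine to the weight \<open>1 / m\<close>, so the multipliers
  are averages of increments of \<open>r\<close>. The bound on the index \<open>j\<close> is uniform in \<open>t\<close>.
\<close>

lemma covariation_integral_large_imp_transform_large:
  fixes r x :: "real \<Rightarrow> real"
  assumes r: "continuous_on UNIV r" and x: "continuous_on UNIV x"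
    and "0 < \<epsilon>" "0 \<le> c" "c \<le> \<eta> / 4" "0 < \<eta>" and t: "t \<in> {0..1}"
    and r_le: "\<And>s. \<bar>r (s + \<epsilon>) - r s\<bar> \<le> c"
    and x_le: "\<And>s s'. \<bar>s - s'\<bar> \<le> \<epsilon> \<Longrightarrow> \<bar>x s - x s'\<bar> \<le> 1"
    and large: "\<eta> < \<bar>1 / \<epsilon> * integral {0..t} (\<lambda>s. (r (s + \<epsilon>) - r s) * (x (s + \<epsilon>) - x s))\<bar>"
  shows "\<forall>\<^sub>F m in sequentially. \<exists>j\<le>nat \<lceil>real m / \<epsilon>\<rceil>. \<eta> / 2 \<le>
    \<bar>\<Sum>u<j. (\<Sum>i\<in>{Suc u - m..u}. (r (real i * (\<epsilon> / real m) + \<epsilon>) - r (real i * (\<epsilon> / real m))) / real m)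
      * (x (real (Suc u) * (\<epsilon> / real m)) - x (real u * (\<epsilon> / real m)))\<bar>"
proof -
  define g where "g s = (r (s + \<epsilon>) - r s) * (x (s + \<epsilon>) - x s)" for s
  have g: "continuous_on {0..1} g"
    unfolding g_def
    by (intro continuous_intros continuous_on_compose2[OF r] continuous_on_compose2[OF x]) auto
  obtain h0 where h0: "0 < h0" "\<And>h. \<lbrakk>0 < h; h < h0\<rbrakk> \<Longrightarrow>
      \<bar>integral {0..t} g - h * (\<Sum>i<nat \<lfloor>t / h\<rfloor>. g (real i * h))\<bar> \<le> \<epsilon> * (\<eta> / 4)"
    using riemann_sum_limit[OF g t, of "\<epsilon> * (\<eta> / 4)"] \<open>0 < \<epsilon>\<close> \<open>0 < \<eta>\<close> by auto
  have "(\<lambda>m. \<epsilon> / real m) \<longlonglongrightarrow> 0"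
    by (rule lim_const_over_n)
  then have "\<forall>\<^sub>F m in sequentially. \<epsilon> / real m < h0"
    using h0(1) by (rule order_tendstoD)
  then show ?thesis
    using eventually_gt_at_top[of 0]
  proof eventually_elim
    fix m :: nat
    assume "\<epsilon> / real m < h0" "0 < m"
    define h where "h = \<epsilon> / real m"
    define j where "j = nat \<lfloor>t / h\<rfloor>"
    define a where "a i = (r (real i * h + \<epsilon>) - r (real i * h)) / real m" for i
    define y where "y i = x (real i * h)" for i
    have h: "0 < h" "h < h0" "real m * h = \<epsilon>"
      using \<open>\<epsilon> / real m < h0\<close> \<open>0 < m\<close> \<open>0 < \<epsilon>\<close> by (auto simp: h_def)
    have shift: "real (i + m) * h = real i * h + \<epsilon>" for i
      using h(3) by (simp add: algebra_simps)
    have "j \<le> nat \<lceil>real m / \<epsilon>\<rceil>"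
    proof -
      have "t / h \<le> real m / \<epsilon>"
        using t \<open>0 < \<epsilon>\<close> \<open>0 < m\<close> by (simp add: h_def field_simps)
      then have "\<lfloor>t / h\<rfloor> \<le> \<lceil>real m / \<epsilon>\<rceil>"
        by linarith
      then show ?thesis
        unfolding j_def by (rule nat_mono)
    qed
    moreover have "\<eta> / 2 \<le> \<bar>\<Sum>u<j. (\<Sum>i\<in>{Suc u - m..u}. a i) * (y (Suc u) - y u)\<bar>"
    proof -
      have "h * (\<Sum>i<j. g (real i * h)) = \<epsilon> * (\<Sum>i<j. a i * (y (i + m) - y i))"
        unfolding sum_distrib_left
        by (intro sum.cong refl, simp only: g_def a_def y_def shift) (simp add: h_def)
      then have "\<bar>integral {0..t} g - \<epsilon> * (\<Sum>i<j. a i * (y (i + m) - y i))\<bar> \<le> \<epsilon> * (\<eta> / 4)"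
        using h0(2)[OF h(1,2)] by (simp add: j_def)
      then have "\<bar>(integral {0..t} g - \<epsilon> * (\<Sum>i<j. a i * (y (i + m) - y i))) / \<epsilon>\<bar> \<le> \<eta> / 4"
        using \<open>0 < \<epsilon>\<close> by (simp add: field_simps)
      then have riemann: "\<bar>1 / \<epsilon> * integral {0..t} g - (\<Sum>i<j. a i * (y (i + m) - y i))\<bar> \<le> \<eta> / 4"
        using \<open>0 < \<epsilon>\<close> by (simp add: diff_divide_distrib)
      have "\<bar>(\<Sum>i<j. a i * (y (i + m) - y i)) - (\<Sum>i<j. a i * (y (min (i + m) j) - y i))\<bar> \<le> c"
      proof (rule sum_shift_boundary)
        show "\<bar>a i\<bar> \<le> c / real m" for i
          unfolding a_def using r_le[of "real i * h"] \<open>0 < m\<close> by (simp add: divide_right_mono)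
        fix p q :: nat assume "q \<le> p" "p \<le> q + m"
        then have "0 \<le> real p - real q" "real p - real q \<le> real m"
          by auto
        then have "0 \<le> (real p - real q) * h" "(real p - real q) * h \<le> real m * h"
          using h(1) by (auto intro: mult_right_mono)
        then have "\<bar>real p * h - real q * h\<bar> \<le> \<epsilon>"
          using h(3) by (simp add: algebra_simps)
        then show "\<bar>y p - y q\<bar> \<le> 1"
          unfolding y_def by (rule x_le)
      qed fact+
      then have "\<eta> - \<eta> / 4 - \<eta> / 4 \<le> \<bar>\<Sum>i<j. a i * (y (min (i + m) j) - y i)\<bar>"
        using riemann large[folded g_def] \<open>c \<le> \<eta> / 4\<close> by linarith
      then show ?thesis
        unfolding sum_shift_eq_transform[OF \<open>0 < m\<close>] by simp
    qed
    ultimately show "\<exists>j\<le>nat \<lceil>real m / \<epsilon>\<rceil>. \<eta> / 2 \<le>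
      \<bar>\<Sum>u<j. (\<Sum>i\<in>{Suc u - m..u}. (r (real i * (\<epsilon> / real m) + \<epsilon>) - r (real i * (\<epsilon> / real m))) / real m)
        * (x (real (Suc u) * (\<epsilon> / real m)) - x (real u * (\<epsilon> / real m)))\<bar>"
      unfolding a_def y_def h_def by blast
  qed
qed

lemma covariation_approx_eq_integral:
  assumes "continuous_process M X" "continuous_process M Y" "\<omega> \<in> space M"
  shows "covariation_approx X Y \<epsilon> t \<omega> = 1 / \<epsilon> * integral {0..t} (\<lambda>s.
    (extend X (s + \<epsilon>) \<omega> - extend X s \<omega>) * (extend Y (s + \<epsilon>) \<omega> - extend Y s \<omega>))"
  unfolding covariation_approx_def
  by (subst set_borel_integral_eq_integral(2))
    (auto intro!: borel_integrable_atLeastAtMost' continuous_intros assms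
      continuous_on_compose2[OF continuous_on_extend[of M X \<omega> UNIV]]
      continuous_on_compose2[OF continuous_on_extend[of M Y \<omega> UNIV]] continuous_on_extend[of M])

lemma usual_filtration_extend:
  assumes "usual_filtration M H"
  shows "subalgebra M (extend H t)"
    and "s \<le> t \<Longrightarrow> subalgebra (extend H t) (extend H s)"
proof -
  interpret filtration "space M" "extend H"
    using assms by (simp add: usual_filtration_def)
  show "subalgebra M (extend H t)"
    using assms by (auto simp: usual_filtration_def extend_def)
  show "subalgebra (extend H t) (extend H s)" if "s \<le> t"
    using sets_F_mono[OF that] space_F by (simp add: subalgebra_def)
qed

lemma martingale_orthogonal:
  assumes "prob_space M" "usual_filtration M H" and X: "martingale M H X"
    and st: "s \<in> {0..1}" "t \<in> {s..1}"
    and W: "W \<in> borel_measurable (H s)" "\<And>\<omega>. \<omega> \<in> space M \<Longrightarrow> \<bar>W \<omega>\<bar> \<le> b"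
  shows "(\<integral>\<omega>. W \<omega> * (X t \<omega> - X s \<omega>) \<partial>M) = 0"
proof -
  interpret prob_space M by fact
  have sub: "subalgebra M (H s)"
    using assms(2) st(1) by (simp add: usual_filtration_def)
  interpret finite_measure_subalgebra M "H s"
    by unfold_locales (rule sub)
  have int: "integrable M (X s)" "integrable M (X t)"
    using X st by (auto simp: martingale_def)
  have [measurable]: "W \<in> borel_measurable M"
    using measurable_from_subalg[OF sub W(1)] .
  have bounded: "integrable M (\<lambda>\<omega>. W \<omega> * g \<omega>)" if "integrable M g" for g :: "'a \<Rightarrow> real"
    by (rule integrable_bounded_mult[OF _ W(2) that]) measurable
  have "AE \<omega> in M. real_cond_exp M (H s) (X t) \<omega> = X s \<omega>"
    using X st by (simp add: martingale_def)
  then have "(\<integral>\<omega>. W \<omega> * real_cond_exp M (H s) (X t) \<omega> \<partial>M) = (\<integral>\<omega>. W \<omega> * X s \<omega> \<partial>M)"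
    using int by (intro integral_cong_AE) auto
  then have "(\<integral>\<omega>. W \<omega> * X t \<omega> \<partial>M) = (\<integral>\<omega>. W \<omega> * X s \<omega> \<partial>M)"
    using real_cond_exp_intg(2)[OF bounded[OF int(2)] W(1)] int(2) by simp
  then show ?thesis
    using bounded[OF int(1)] bounded[OF int(2)] by (simp add: right_diff_distrib)
qed

lemma discrete_martingale_grid:
  assumes "prob_space M" "usual_filtration M H" and X: "martingale M H X"
    and zero: "\<And>\<omega>. \<omega> \<in> space M \<Longrightarrow> X 0 \<omega> = 0" and "0 \<le> h"
  shows "discrete_martingale M (\<lambda>k. extend H (real k * h)) (\<lambda>k. extend X (real k * h))"
proof -
  interpret prob_space M by fact
  have mono: "real k * h \<le> real (Suc k) * h" for k
    using \<open>0 \<le> h\<close> by (intro mult_right_mono) auto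
  show ?thesis
  proof
    fix k
    show "subalgebra M (extend H (real k * h))"
      using usual_filtration_extend(1)[OF assms(2)] .
    show "subalgebra (extend H (real (Suc k) * h)) (extend H (real k * h))"
      using usual_filtration_extend(2)[OF assms(2) mono] .
    show "extend X (real k * h) \<in> borel_measurable (extend H (real k * h))"
      using X by (auto simp: martingale_def adapted_def extend_def)
    show "integrable M (extend X (real k * h))"
      using X by (auto simp: martingale_def extend_def)
    show "extend X (real 0 * h) \<omega> = 0" if "\<omega> \<in> space M" for \<omega>
      using zero[OF that] by (simp add: extend_def)
    fix W and b :: real
    assume "W \<in> borel_measurable (extend H (real k * h))" "\<And>\<omega>. \<omega> \<in> space M \<Longrightarrow> \<bar>W \<omega>\<bar> \<le> b"
    then show "(\<integral>\<omega>. W \<omega> * (extend X (real (Suc k) * h) \<omega> - extend X (real k * h) \<omega>) \<partial>M) = 0"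
      unfolding extend_def using mono[of k]
      by (intro martingale_orthogonal[OF assms(1,2) X]) auto
  qed
qed

text \<open>
  Strong predictability makes the increments \<open>R\<^bsub>s + \<epsilon>\<^esub> - R\<^sub>s\<close> known at time \<open>s\<close>. Beyond time 1,
  both the process and the filtration are constant.
\<close>

lemma strongly_predictable_look_ahead:
  assumes "usual_filtration M H" and R: "\<forall>\<epsilon>\<le>\<delta>. adapted H (\<lambda>t. extend R (\<epsilon> + t))"
    and "0 \<le> \<epsilon>" "\<epsilon> \<le> \<delta>" "0 \<le> s" "s \<le> t"
  shows "extend R (s + \<epsilon>) \<in> borel_measurable (extend H t)"
proof -
  have "extend R (s + \<epsilon>) \<in> borel_measurable (extend H s)"
  proof (cases "s \<le> 1")
    case True
    then have "extend R (\<epsilon> + s) \<in> borel_measurable (H s)"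
      using R \<open>0 \<le> s\<close> \<open>\<epsilon> \<le> \<delta>\<close> by (auto simp: adapted_def)
    then show ?thesis
      using True \<open>0 \<le> s\<close> by (simp add: extend_def[of H] add.commute)
  next
    case False
    have "extend R (0 + 1) \<in> borel_measurable (H 1)"
      using R \<open>0 \<le> \<epsilon>\<close> \<open>\<epsilon> \<le> \<delta>\<close> unfolding adapted_def by (meson atLeastAtMost_iff order_trans zero_le_one order_refl)
    then show ?thesis
      using False \<open>0 \<le> \<epsilon>\<close> by (simp add: extend_def)
  qed
  then show ?thesis
    using measurable_from_subalg[OF usual_filtration_extend(2)[OF assms(1) \<open>s \<le> t\<close>]] by blast
qed

text \<open>
  The quantitative core, for a fixed \<open>\<epsilon>\<close> and a continuous martingale \<open>X\<close> that is only assumed to be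
  integrable. The multipliers \<open>v\<close> are averages of at most \<open>m\<close> increments of \<open>R\<close> over \<open>[s, s + \<epsilon>]\<close>;
  they are truncated at \<open>c\<close> in order to apply the maximal inequality, and the truncation is inactive on
  \<open>A\<close>, where these increments are at most \<open>c\<close>. The resulting bound does not depend on \<open>m\<close>.
\<close>

lemma prob_covariation_large_le:
  assumes "prob_space M" "usual_filtration M H"
    and R: "continuous_process M R" "\<forall>\<epsilon>\<le>\<delta>. adapted H (\<lambda>t. extend R (\<epsilon> + t))"
    and X: "continuous_process M X" "martingale M H X" "\<And>\<omega>. \<omega> \<in> space M \<Longrightarrow> X 0 \<omega> = 0"
    and \<epsilon>: "0 < \<epsilon>" "\<epsilon> \<le> \<delta>" and "0 \<le> c" "c \<le> \<eta> / 4" "0 < \<eta>"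
    and A: "A \<subseteq> space M"
    and R_le: "\<And>\<omega> s. \<omega> \<in> A \<Longrightarrow> \<bar>extend R (s + \<epsilon>) \<omega> - extend R s \<omega>\<bar> \<le> c"
    and X_le: "\<And>\<omega> s s'. \<lbrakk>\<omega> \<in> A; \<bar>s - s'\<bar> \<le> \<epsilon>\<rbrakk> \<Longrightarrow> \<bar>extend X s \<omega> - extend X s' \<omega>\<bar> \<le> 1"
    and large: "\<And>\<omega>. \<omega> \<in> A \<Longrightarrow> \<exists>t\<in>{0..1}. \<eta> < \<bar>covariation_approx R X \<epsilon> t \<omega>\<bar>"
  shows "measure M A \<le> 4 * c / \<eta> * (\<integral>\<omega>. \<bar>X 1 \<omega>\<bar> \<partial>M)"
proof -
  interpret prob_space M by fact
  define h where "h m = \<epsilon> / real m" for m :: nat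
  define n where "n m = nat \<lceil>real m / \<epsilon>\<rceil>" for m :: nat
  define V where "V m u \<omega> = (\<Sum>i\<in>{Suc u - m..u}.
    (extend R (real i * h m + \<epsilon>) \<omega> - extend R (real i * h m) \<omega>) / real m)" for m u \<omega>
  define v where "v m u \<omega> = max (- c) (min c (V m u \<omega>))" for m u \<omega>
  define B where "B m = {\<omega> \<in> space M. \<exists>j\<le>n m. \<eta> / 2 \<le> \<bar>\<Sum>u<j. v m u \<omega> *
    (extend X (real (Suc u) * h m) \<omega> - extend X (real u * h m) \<omega>)\<bar>}" for m
  have h: "0 \<le> h m" for m
    using \<epsilon> by (simp add: h_def)
  have v: "v m u \<in> borel_measurable (extend H (real u * h m))" for m u
  proof -
    have "extend R (real i * h m + e) \<in> borel_measurable (extend H (real u * h m))"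
      if "i \<le> u" "e \<in> {0, \<epsilon>}" for i e
      using that h \<epsilon> by (intro strongly_predictable_look_ahead[OF assms(2) R(2)]) (auto intro: mult_right_mono)
    from this[of _ \<epsilon>] this[of _ 0] have "V m u \<in> borel_measurable (extend H (real u * h m))"
      unfolding V_def by (intro borel_measurable_sum borel_measurable_divide borel_measurable_diff) auto
    then show ?thesis
      unfolding v_def by measurable
  qed
  have v_le: "\<bar>v m u \<omega>\<bar> \<le> c" for m u \<omega>
    using \<open>0 \<le> c\<close> by (auto simp: v_def)
  have B_le: "measure M (B m) \<le> 4 * c / \<eta> * (\<integral>\<omega>. \<bar>X 1 \<omega>\<bar> \<partial>M)" and B_sets: "B m \<in> sets M" for m
  proof -
    interpret discrete_martingale M "\<lambda>k. extend H (real k * h m)" "\<lambda>k. extend X (real k * h m)"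
      by (rule discrete_martingale_grid[OF assms(1,2) X(2,3) h])
    have B_eq: "B m = {\<omega> \<in> space M. \<exists>j\<le>n m. \<eta> / 2 \<le> \<bar>transform (v m) j \<omega>\<bar>}"
      by (simp add: B_def transform_def)
    have [measurable]: "transform (v m) j \<in> borel_measurable M" for j
      using adapted_M[OF transform_adapted[OF v order_refl]] .
    show "B m \<in> sets M"
      unfolding B_eq by measurable
    have "measure M (B m) \<le> 2 * c / (\<eta> / 2) * (\<integral>\<omega>. \<bar>extend X (real (n m) * h m) \<omega>\<bar> \<partial>M)"
      unfolding B_eq using \<open>0 < \<eta>\<close> by (intro prob_max_transform_ge v v_le) auto
    also have "\<dots> \<le> 2 * c / (\<eta> / 2) * (\<integral>\<omega>. \<bar>X 1 \<omega>\<bar> \<partial>M)"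
    proof (rule mult_left_mono)
      show "(\<integral>\<omega>. \<bar>extend X (real (n m) * h m) \<omega>\<bar> \<partial>M) \<le> (\<integral>\<omega>. \<bar>X 1 \<omega>\<bar> \<partial>M)"
        (* n m is chosen so that the grid reaches time 1, where the process stops moving; for m = 0
           the mesh is 0 by division by zero and the process stays at its initial value *)
      proof (cases "m = 0")
        case True
        have "(\<integral>\<omega>. \<bar>extend X (real (n m) * h m) \<omega>\<bar> \<partial>M) = (\<integral>\<omega>. 0 \<partial>M)"
          using True X(3) by (intro Bochner_Integration.integral_cong) (auto simp: h_def extend_def)
        then show ?thesis
          by simp
      next
        case False
        have "real m / \<epsilon> \<le> real (n m)"
          unfolding n_def by (rule real_nat_ceiling_ge)
        then have "1 \<le> real (n m) * h m"
          using False \<epsilon> by (simp add: h_def field_simps)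
        then show ?thesis
          by (simp add: extend_def)
      qed
    qed (use \<open>0 \<le> c\<close> \<open>0 < \<eta>\<close> in simp)
    finally show "measure M (B m) \<le> 4 * c / \<eta> * (\<integral>\<omega>. \<bar>X 1 \<omega>\<bar> \<partial>M)"
      by simp
  qed
  show ?thesis
  proof (rule measure_eventually_le[OF B_sets B_le])
    fix \<omega> assume \<omega>: "\<omega> \<in> A"
    then have sp: "\<omega> \<in> space M"
      using A by blast
    have V_le: "\<bar>V m u \<omega>\<bar> \<le> c" for m u
    proof -
      have "\<bar>V m u \<omega>\<bar> \<le> (\<Sum>i\<in>{Suc u - m..u}. c / real m)"
        unfolding V_def using R_le[OF \<omega>]
        by (intro order_trans[OF sum_abs] sum_mono) (auto intro!: divide_right_mono)
      also have "\<dots> = real (Suc u - (Suc u - m)) * (c / real m)"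
        by simp
      also have "\<dots> \<le> real m * (c / real m)"
        using \<open>0 \<le> c\<close> by (intro mult_right_mono) auto
      also have "\<dots> \<le> c"
        using \<open>0 \<le> c\<close> by simp
      finally show ?thesis .
    qed
    have v_eq: "v m u \<omega> = V m u \<omega>" for m u
      using V_le[of m u] unfolding v_def abs_le_iff by (simp add: min_absorb2 max_absorb2)
    obtain t where t: "t \<in> {0..1}" "\<eta> < \<bar>covariation_approx R X \<epsilon> t \<omega>\<bar>"
      using large[OF \<omega>] by blast
    show "\<forall>\<^sub>F m in sequentially. \<omega> \<in> B m"
      using covariation_integral_large_imp_transform_large[OF continuous_on_extend[OF R(1) sp]
          continuous_on_extend[OF X(1) sp] \<epsilon>(1) \<open>0 \<le> c\<close> \<open>c \<le> \<eta> / 4\<close> \<open>0 < \<eta>\<close> t(1) R_le[OF \<omega>] X_le[OF \<omega>]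
          t(2)[unfolded covariation_approx_eq_integral[OF R(1) X(1) sp]]]
      using sp by (simp add: B_def v_eq V_def h_def n_def)
  qed
qed

lemma continuous_process_stopped:
  assumes N: "continuous_process M N" and \<tau>: "\<And>\<omega>. \<omega> \<in> space M \<Longrightarrow> \<tau> \<omega> \<in> {0..1}"
    and X: "martingale M H (\<lambda>t \<omega>. N (min t (\<tau> \<omega>)) \<omega> - N 0 \<omega>)"
  shows "continuous_process M (\<lambda>t \<omega>. N (min t (\<tau> \<omega>)) \<omega> - N 0 \<omega>)"
  unfolding continuous_process_def
proof (intro conjI ballI)
  fix t :: real assume "t \<in> {0..1}"
  then show "(\<lambda>\<omega>. N (min t (\<tau> \<omega>)) \<omega> - N 0 \<omega>) \<in> borel_measurable M"
    using X by (auto simp: martingale_def)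
next
  fix \<omega> assume "\<omega> \<in> space M"
  then have path: "continuous_on {0..1} (\<lambda>t. N t \<omega>)" and \<tau>01: "0 \<le> \<tau> \<omega>" "\<tau> \<omega> \<le> 1"
    using N \<tau>[of \<omega>] by (simp_all add: continuous_process_def)
  have "continuous_on {0..1} (\<lambda>t. min t (\<tau> \<omega>))"
    by (intro continuous_intros)
  moreover have "(\<lambda>t. min t (\<tau> \<omega>)) ` {0..1} \<subseteq> {0..1}"
    using \<tau>01 by auto
  ultimately have "continuous_on {0..1} (\<lambda>t. N (min t (\<tau> \<omega>)) \<omega>)"
    by (rule continuous_on_compose2[OF path])
  then show "continuous_on {0..1} (\<lambda>t. N (min t (\<tau> \<omega>)) \<omega> - N 0 \<omega>)"
    by (intro continuous_on_diff continuous_on_const)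
qed

text \<open>
  Up to an event of probability less than \<open>e / 4\<close>, the local martingale \<open>N\<close> has the increments of an
  integrable martingale \<open>X\<close>. With \<open>X\<close> fixed, the oscillation bound \<open>c\<close> of \<open>R\<close> can be taken so
  small that the bound of \<open>prob_covariation_large_le\<close> is at most \<open>e / 4\<close>; the two exceptional events
  of the moduli of continuity account for the rest of \<open>e\<close>.
\<close>

lemma strongly_predictable_covariation_zero:
  assumes "prob_space M" "usual_filtration M H"
    and R: "continuous_process M R" "strongly_predictable H R"
    and N: "continuous_local_martingale M H N"
  shows "has_covariation M R N (\<lambda>t \<omega>. 0)"
  unfolding has_covariation_def
proof (intro conjI allI impI)
  show "continuous_process M (\<lambda>t \<omega>. 0)"
    by (simp add: continuous_process_def)
  interpret prob_space M by fact
  fix \<eta> :: real assume \<eta>: "0 < \<eta>"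
  obtain \<delta> where \<delta>: "0 < \<delta>" "\<forall>\<epsilon>\<le>\<delta>. adapted H (\<lambda>t. extend R (\<epsilon> + t))"
    using R(2) by (auto simp: strongly_predictable_def)
  obtain \<tau> :: "nat \<Rightarrow> 'a \<Rightarrow> real" where
    N_cont: "continuous_process M N" and
    \<tau>: "\<And>n. stopping_time (extend H) (\<tau> n)"
      "\<And>n \<omega>. \<omega> \<in> space M \<Longrightarrow> \<tau> n \<omega> \<in> {0..1}"
      "\<And>n \<omega>. \<omega> \<in> space M \<Longrightarrow> \<tau> n \<omega> \<le> \<tau> (Suc n) \<omega>"
      "AE \<omega> in M. \<exists>n. \<tau> n \<omega> = 1"
      "\<And>n. martingale M H (\<lambda>t \<omega>. N (min t (\<tau> n \<omega>)) \<omega> - N 0 \<omega>)"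
    using N unfolding continuous_local_martingale_def by blast
  have [measurable]: "\<tau> n \<in> borel_measurable M" for n
    using usual_filtration_extend(1)[OF assms(2)]
    by (intro measurable_stopping_time[OF \<tau>(1)]) (auto simp: subalgebra_def)
  define S where "S \<epsilon> = {\<omega>\<in>space M.
    (SUP t\<in>{0..1}. ereal \<bar>covariation_approx R N \<epsilon> t \<omega> - 0\<bar>) > ereal \<eta>}" for \<epsilon>
  show "((\<lambda>\<epsilon>. measure M {\<omega>\<in>space M.
      (SUP t\<in>{0..1}. ereal \<bar>covariation_approx R N \<epsilon> t \<omega> - 0\<bar>) > ereal \<eta>}) \<longlongrightarrow> 0) (at_right 0)"
    unfolding S_def[symmetric]
  proof (rule tendstoI)
    fix e :: real assume e: "0 < e"
    have "\<exists>n. prob {\<omega>\<in>space M. \<not> 1 \<le> \<tau> n \<omega>} < e / 4"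
    proof (rule ex_small_complement)
      show "AE \<omega> in M. \<exists>n. 1 \<le> \<tau> n \<omega>"
        using \<tau>(4) by eventually_elim (metis order_refl)
    qed (use \<tau>(3) e in \<open>auto intro: order_trans\<close>)
    then obtain n where n: "prob {\<omega>\<in>space M. \<not> 1 \<le> \<tau> n \<omega>} < e / 4"
      by blast
    define X where "X t \<omega> = N (min t (\<tau> n \<omega>)) \<omega> - N 0 \<omega>" for t \<omega>
    have X: "continuous_process M X" "martingale M H X"
      using continuous_process_stopped[OF N_cont \<tau>(2) \<tau>(5), of n] \<tau>(5)[of n] by (simp_all add: X_def[abs_def])
    have X0: "X 0 \<omega> = 0" if "\<omega> \<in> space M" for \<omega>
      using \<tau>(2)[OF that, of n] by (simp add: X_def)
    define K where "K = (\<integral>\<omega>. \<bar>X 1 \<omega>\<bar> \<partial>M)"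
    have K: "0 \<le> K"
      unfolding K_def by (rule Bochner_Integration.integral_nonneg) simp
    (* The weak-type bound on the good event is 4 * c / \<eta> * K; the second entry makes it at most e / 4,
       and K + 1 instead of K avoids a division by zero. *)
    define c where "c = min (\<eta> / 4) (e * \<eta> / 16 / (K + 1))"
    have c: "0 < c" "c \<le> \<eta> / 4"
      unfolding c_def using \<eta> e K by (simp, intro min.cobounded1)
    have cK: "4 * c / \<eta> * K \<le> e / 4"
    proof -
      have "c \<le> e * \<eta> / 16 / (K + 1)"
        unfolding c_def by (rule min.cobounded2)
      then have "c * (K + 1) \<le> e * \<eta> / 16"
        using K by (subst (asm) pos_le_divide_eq) auto
      moreover have "c * K \<le> c * (K + 1)"
        using c(1) by simp
      ultimately have "c * K \<le> e * \<eta> / 16"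
        by linarith
      then show ?thesis
        using \<eta> by (simp add: field_simps)
    qed
    obtain \<kappa>R GR where GR: "0 < \<kappa>R" "GR \<in> sets M" "prob (space M - GR) < e / 4"
      "\<And>\<omega> s t. \<lbrakk>\<omega> \<in> GR; \<bar>s - t\<bar> < \<kappa>R\<rbrakk> \<Longrightarrow> \<bar>extend R s \<omega> - extend R t \<omega>\<bar> \<le> c"
      using continuous_process_modulus[OF R(1) c(1), of "e / 4"] e by auto
    obtain \<kappa>X GX where GX: "0 < \<kappa>X" "GX \<in> sets M" "prob (space M - GX) < e / 4"
      "\<And>\<omega> s t. \<lbrakk>\<omega> \<in> GX; \<bar>s - t\<bar> < \<kappa>X\<rbrakk> \<Longrightarrow> \<bar>extend X s \<omega> - extend X t \<omega>\<bar> \<le> 1"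
      using continuous_process_modulus[OF X(1), of 1 "e / 4"] e by auto
    have small: "measure M (S \<epsilon>) < e" if \<epsilon>: "0 < \<epsilon>" "\<epsilon> < min \<delta> (min \<kappa>R \<kappa>X)" for \<epsilon>
    (* the value of measure at a set that is not an event is 0 *)
    proof (cases "S \<epsilon> \<in> sets M")
      case False
      then show ?thesis
        using e by (simp add: measure_notin_sets)
    next
      case True
      let ?T = "{\<omega>\<in>space M. \<not> 1 \<le> \<tau> n \<omega>}"
      define A where "A = S \<epsilon> \<inter> GR \<inter> GX - ?T"
      have T: "?T \<in> sets M"
        by measurable
      have A_sets: "A \<in> sets M"
        using True GR(2) GX(2) T by (auto simp: A_def)
      have "measure M A \<le> 4 * c / \<eta> * (\<integral>\<omega>. \<bar>X 1 \<omega>\<bar> \<partial>M)"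
      proof (rule prob_covariation_large_le[OF assms(1,2) R(1) \<delta>(2) X X0])
        show "A \<subseteq> space M"
          by (auto simp: A_def S_def)
        show "\<bar>extend R (s + \<epsilon>) \<omega> - extend R s \<omega>\<bar> \<le> c" if "\<omega> \<in> A" for \<omega> s
          using that \<epsilon> by (intro GR(4)) (auto simp: A_def)
        show "\<bar>extend X s \<omega> - extend X s' \<omega>\<bar> \<le> 1" if "\<omega> \<in> A" "\<bar>s - s'\<bar> \<le> \<epsilon>" for \<omega> s s'
          using that \<epsilon> by (intro GX(4)) (auto simp: A_def)
        fix \<omega> assume \<omega>: "\<omega> \<in> A"
        then have sp: "\<omega> \<in> space M" "1 \<le> \<tau> n \<omega>"
          by (auto simp: A_def S_def)
        have "extend X s \<omega> = extend N s \<omega> - N 0 \<omega>" for s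
          using sp(2) by (simp add: extend_def X_def min_def)
        then have "covariation_approx R X \<epsilon> t \<omega> = covariation_approx R N \<epsilon> t \<omega>" for t
          by (simp add: covariation_approx_def)
        then show "\<exists>t\<in>{0..1}. \<eta> < \<bar>covariation_approx R X \<epsilon> t \<omega>\<bar>"
          using \<omega> by (auto simp: A_def S_def less_SUP_iff)
      qed (use \<epsilon> c \<eta> in auto)
      then have "measure M A \<le> e / 4"
        using cK by (simp add: K_def)
      moreover have "measure M (S \<epsilon>) \<le> measure M (((A \<union> (space M - GR)) \<union> (space M - GX)) \<union> ?T)"
        using A_sets GR(2) GX(2) T by (intro finite_measure_mono) (auto simp: A_def S_def)
      moreover have "\<dots> \<le> measure M ((A \<union> (space M - GR)) \<union> (space M - GX)) + measure M ?T"
        using A_sets GR(2) GX(2) T by (intro measure_Un_le) auto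
      moreover have "measure M ((A \<union> (space M - GR)) \<union> (space M - GX))
          \<le> measure M (A \<union> (space M - GR)) + measure M (space M - GX)"
        using A_sets GR(2) GX(2) by (intro measure_Un_le) auto
      moreover have "measure M (A \<union> (space M - GR)) \<le> measure M A + measure M (space M - GR)"
        using A_sets GR(2) by (intro measure_Un_le) auto
      ultimately show ?thesis
        using n GR(3) GX(3) by linarith
    qed
    show "\<forall>\<^sub>F \<epsilon> in at_right 0. dist (measure M (S \<epsilon>)) 0 < e"
      unfolding eventually_at_right_field
      using small \<delta>(1) GR(1) GX(1)
      by (intro exI[of _ "min \<delta> (min \<kappa>R \<kappa>X)"]) auto
  qed
qed

lemma continuous_local_martingale_zero:
  assumes "prob_space M" "usual_filtration M H"
  shows "continuous_local_martingale M H (\<lambda>t \<omega>. 0)"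
proof -
  interpret prob_space M by fact
  have "martingale M H (\<lambda>t \<omega>. 0)"
    unfolding martingale_def
  proof (intro conjI ballI)
    fix s :: real assume "s \<in> {0..1}"
    then have "subalgebra M (H s)"
      using assms(2) by (simp add: usual_filtration_def)
    then interpret finite_measure_subalgebra M "H s"
      by unfold_locales
    show "AE \<omega> in M. real_cond_exp M (H s) (\<lambda>\<omega>. 0) \<omega> = 0"
      by (rule real_cond_exp_F_meas) auto
  qed (auto simp: adapted_def)
  then show ?thesis
    unfolding continuous_local_martingale_def
    by (auto simp: continuous_process_def adapted_def stopping_time_const intro!: exI[of _ "\<lambda>n \<omega>. 1"])
qed

theorem corollary3p14:
  fixes M :: "'a measure"
    and H :: "real \<Rightarrow> 'a measure"
    and R :: "real \<Rightarrow> 'a \<Rightarrow> real"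
  assumes "prob_space M"
    and "usual_filtration M H"
    and "continuous_process M R"
    and "strongly_predictable H R"
  shows "weak_dirichlet M H R"
  unfolding weak_dirichlet_def
proof (intro exI conjI allI impI)
  show "continuous_local_martingale M H (\<lambda>t \<omega>. 0)"
    using assms(1,2) by (rule continuous_local_martingale_zero)
  show "has_covariation M R N (\<lambda>t \<omega>. 0)" if "continuous_local_martingale M H N" for N
    using assms that by (rule strongly_predictable_covariation_zero)
qed (use assms(3) in auto)

end
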